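(* Let $n \ge 2$ be an integer and let $P$ be an $n$-crossing knot projection. Then there exists a choice of crossing data for $P$ (that is, for each crossing of $P$, a choice of the vertical order of the $n$ strands passing through it) such that the knot represented by $P$ with this crossing data is the trivial knot.
   Context: A multi-crossing of multiplicity $n$, also called an $n$-crossing, is a singular point of a projection at which $n$ strands cross each other so that each strand passes straight through the crossing, thus bisecting it: of the $2n$ ends at the crossing in cyclic order, each strand joins two opposite ends. An $n$-crossing projection is a projection, on the sphere $S^2$ (or the plane), in which the only singular points are $n$-crossings. A knot projection is a projection of a single closed curve. Crossing data at an $n$-crossing is a linear order, from top to bottom, of the $n$ strands through it. A projection together with crossing data at every crossing determines a knot. In the statement, $P$ is considered as a projection whose crossing data may be chosen freely. *)

theory Defs
  imports "HOL-Analysis.Analysis"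
begin

text \<open>
  A closed curve in the plane is a continuous function on the unit circle
  \<^term>\<open>sphere 0 1 :: complex set\<close>, with values in \<^typ>\<open>complex\<close>. Space is
  \<^typ>\<open>complex \<times> real\<close>, the second component being the height, and knots project to the plane
  by \<^term>\<open>fst\<close>. Everything is topological: no smoothness or piecewise linearity is required.
  A strand through a point of the curve is named by its parameter in the circle.
\<close>

definition strands :: "(complex \<Rightarrow> complex) \<Rightarrow> complex \<Rightarrow> complex set" where
  "strands P p = {u \<in> sphere 0 1. P u = p}"

definition singular_points :: "(complex \<Rightarrow> complex) \<Rightarrow> complex set" where
  "singular_points P = {p. \<exists>u \<in> strands P p. \<exists>v \<in> strands P p. u \<noteq> v}"

text \<open>The \<open>k\<close>-th of the \<open>n\<close> equally spaced diameters of the open unit disc.\<close>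

definition diameter_line :: "nat \<Rightarrow> nat \<Rightarrow> complex set" where
  "diameter_line n k = (\<lambda>r. complex_of_real r * cis (pi * real k / real n)) ` {-1<..<1}"

text \<open>
  At an \<open>n\<close>-crossing \<open>p\<close>, a chart \<open>f\<close> carries a neighbourhood \<open>U\<close> of \<open>p\<close> to the open unit disc
  and the \<open>n\<close> pieces \<open>A k\<close> of the curve inside \<open>U\<close> to the \<open>n\<close> diameters. The \<open>2n\<close> ends at \<open>p\<close> are
  thus the \<open>2n\<close> radii, and each strand joins two opposite ones.
\<close>

definition is_n_crossing :: "nat \<Rightarrow> (complex \<Rightarrow> complex) \<Rightarrow> complex \<Rightarrow> bool" where
  "is_n_crossing n P p \<longleftrightarrow>
    (\<exists>U f f' A. open U \<and> p \<in> U \<and> homeomorphism U (ball 0 1) f f' \<and> f p = 0 \<and>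
      {u \<in> sphere 0 1. P u \<in> U} = (\<Union>k<n. A k) \<and> disjoint_family_on A {..<n} \<and>
      (\<forall>k<n. \<exists>g. homeomorphism (A k) (diameter_line n k) (f \<circ> P) g))"

definition n_crossing_knot_projection :: "nat \<Rightarrow> (complex \<Rightarrow> complex) \<Rightarrow> bool" where
  "n_crossing_knot_projection n P \<longleftrightarrow>
    continuous_on (sphere 0 1) P \<and> finite (singular_points P) \<and>
    (\<forall>p \<in> singular_points P. is_n_crossing n P p)"

text \<open>\<^prop>\<open>(u, v) \<in> D p\<close> means that at the crossing \<open>p\<close> the strand \<open>u\<close> is above \<open>v\<close> (or equal to it).\<close>

definition crossing_data :: "(complex \<Rightarrow> complex) \<Rightarrow> (complex \<Rightarrow> complex rel) \<Rightarrow> bool" where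
  "crossing_data P D \<longleftrightarrow> (\<forall>p \<in> singular_points P. linear_order_on (strands P p) (D p))"

text \<open>
  The crossing data determine the knot only up to isotopy. Accordingly \<open>represents P D K\<close> holds for
  every \<open>K\<close> obtained by lifting the projection with heights in the prescribed order.
\<close>

definition represents ::
  "(complex \<Rightarrow> complex) \<Rightarrow> (complex \<Rightarrow> complex rel) \<Rightarrow> (complex \<times> real) set \<Rightarrow> bool" where
  "represents P D K \<longleftrightarrow>
    (\<exists>h. continuous_on (sphere 0 1) h \<and>
      (\<forall>p \<in> singular_points P. \<forall>u v. (u, v) \<in> D p \<and> u \<noteq> v \<longrightarrow> h u > h v) \<and>
      K = (\<lambda>u. (P u, h u)) ` sphere 0 1)"

definition ambient_isotopic :: "(complex \<times> real) set \<Rightarrow> (complex \<times> real) set \<Rightarrow> bool" where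
  "ambient_isotopic K L \<longleftrightarrow>
    (\<exists>F. homotopic_with_canon (\<lambda>f. \<exists>g. homeomorphism UNIV UNIV f g) UNIV UNIV id F \<and> F ` K = L)"

definition trivial_knot :: "(complex \<times> real) set \<Rightarrow> bool" where
  "trivial_knot K \<longleftrightarrow> ambient_isotopic K (sphere 0 1 \<times> {0})"

text \<open>
  Sanity checks: there are exactly \<open>n\<close> strands through an \<open>n\<close>-crossing, every choice of crossing
  data is realised by some \<open>K\<close>, and every such \<open>K\<close> is an embedded circle.
\<close>

lemma card_strands:
  assumes "is_n_crossing n P p"
  shows "finite (strands P p)" "card (strands P p) = n"
proof -
  obtain U f f' A where p: "p \<in> U" and f: "homeomorphism U (ball 0 1) f f'" and f0: "f p = 0"
    and A: "{u \<in> sphere 0 1. P u \<in> U} = (\<Union>k<n. A k)" and dis: "disjoint_family_on A {..<n}"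
    and h: "\<forall>k<n. \<exists>g. homeomorphism (A k) (diameter_line n k) (f \<circ> P) g"
    using assms unfolding is_n_crossing_def by (elim exE conjE) (rule that; assumption)
  have inj: "x = p" if "x \<in> U" "f x = 0" for x
    using that p f f0 by (metis homeomorphism_apply1)
  have "\<exists>a. \<forall>u. u \<in> A k \<and> P u = p \<longleftrightarrow> u = a" if k: "k < n" for k
  proof -
    obtain g where g: "homeomorphism (A k) (diameter_line n k) (f \<circ> P) g" using h k by blast
    have z: "0 \<in> diameter_line n k" unfolding diameter_line_def by (rule image_eqI[of _ _ 0]) simp_all
    have gA: "g 0 \<in> A k" using g z unfolding homeomorphism_def by blast
    have "f (P (g 0)) = 0" using homeomorphism_apply2[OF g z] by simp
    moreover have "P (g 0) \<in> U" using gA A k by blast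
    ultimately have "P (g 0) = p" using inj by blast
    moreover have "u = g 0" if "u \<in> A k" "P u = p" for u
      using homeomorphism_apply1[OF g that(1)] that f0 by simp
    ultimately show ?thesis using gA by blast
  qed
  then obtain a where a: "\<And>k u. k < n \<Longrightarrow> u \<in> A k \<and> P u = p \<longleftrightarrow> u = a k" by metis
  have eq: "strands P p = a ` {..<n}"
  proof -
    have "u \<in> strands P p \<longleftrightarrow> u \<in> (\<Union>k<n. A k) \<and> P u = p" for u
      unfolding strands_def A[symmetric] using p by blast
    then have "u \<in> strands P p \<longleftrightarrow> (\<exists>k<n. u = a k)" for u
      using a by (metis UN_iff lessThan_iff)
    then show ?thesis by blast
  qed
  have "inj_on a {..<n}"
  proof (rule inj_onI)
    fix i j assume ij: "i \<in> {..<n}" "j \<in> {..<n}" "a i = a j"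
    then have "a i \<in> A i \<inter> A j" using a by (metis IntI lessThan_iff)
    then show "i = j" using dis ij unfolding disjoint_family_on_def by blast
  qed
  then show "finite (strands P p)" "card (strands P p) = n" unfolding eq by (auto simp: card_image)
qed

lemma represents_exists:
  assumes P: "n_crossing_knot_projection n P" and D: "crossing_data P D"
  shows "\<exists>K. represents P D K"
proof -
  define Z where "Z = (\<Union>p \<in> singular_points P. strands P p)"
  define c where "c u = real (card {v. (u, v) \<in> D (P u)})" for u
  have fin: "finite (strands P p)" if "p \<in> singular_points P" for p
    using P that card_strands unfolding n_crossing_knot_projection_def by blast
  have "finite Z" using P fin unfolding Z_def n_crossing_knot_projection_def by blast
  moreover have "Z \<subseteq> sphere 0 1" unfolding Z_def strands_def by blast
  ultimately have "closedin (top_of_set (sphere 0 1)) Z" "continuous_on Z c"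
    by (auto intro: closed_subset finite_imp_closed continuous_on_finite)
  then obtain h where h: "continuous_on (sphere 0 1) h" and hc: "\<And>u. u \<in> Z \<Longrightarrow> h u = c u"
    using Tietze_unbounded by metis
  have "h u > h v" if p: "p \<in> singular_points P" and uv: "(u, v) \<in> D p" "u \<noteq> v" for p u v
  proof -
    have lo: "linear_order_on (strands P p) (D p)" using D p unfolding crossing_data_def by blast
    then have sub: "D p \<subseteq> strands P p \<times> strands P p" and re: "refl_on (strands P p) (D p)"
      and tr: "trans (D p)" and an: "antisym (D p)"
      unfolding order_on_defs by auto
    have s: "u \<in> strands P p" "v \<in> strands P p" using sub uv by auto
    have "{w. (v, w) \<in> D p} \<subset> {w. (u, w) \<in> D p}"
    proof (rule psubsetI)
      show "{w. (v, w) \<in> D p} \<subseteq> {w. (u, w) \<in> D p}" using tr uv by (auto dest: transD)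
      have "(u, u) \<in> D p" using re s(1) by (meson refl_onD)
      moreover have "(v, u) \<notin> D p" using an uv by (meson antisymD)
      ultimately show "{w. (v, w) \<in> D p} \<noteq> {w. (u, w) \<in> D p}" by blast
    qed
    moreover have "finite {w. (u, w) \<in> D p}"
      by (rule finite_subset[OF _ fin[OF p]]) (use sub in auto)
    ultimately have "c v < c u"
      using s unfolding c_def strands_def by (simp add: psubset_card_mono)
    moreover have "u \<in> Z" "v \<in> Z" using s p unfolding Z_def by auto
    ultimately show ?thesis using hc by simp
  qed
  then show ?thesis using h unfolding represents_def by blast
qed

lemma represents_embedded:
  assumes P: "n_crossing_knot_projection n P" and D: "crossing_data P D" and K: "represents P D K"
  shows "sphere (0::complex) 1 homeomorphic K"
proof -
  obtain h where h: "continuous_on (sphere 0 1) h"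
    and lt: "\<And>p u v. \<lbrakk>p \<in> singular_points P; (u, v) \<in> D p; u \<noteq> v\<rbrakk> \<Longrightarrow> h u > h v"
    and K: "K = (\<lambda>u. (P u, h u)) ` sphere 0 1"
    using K unfolding represents_def by blast
  have "u = v" if "u \<in> sphere 0 1" "v \<in> sphere 0 1" "P u = P v" "h u = h v" for u v
  proof (rule ccontr)
    assume ne: "u \<noteq> v"
    have s: "u \<in> strands P (P u)" "v \<in> strands P (P u)" using that by (auto simp: strands_def)
    then have p: "P u \<in> singular_points P" using ne unfolding singular_points_def by blast
    then have "linear_order_on (strands P (P u)) (D (P u))" using D unfolding crossing_data_def by blast
    then have "(u, v) \<in> D (P u) \<or> (v, u) \<in> D (P u)"
      using s ne unfolding linear_order_on_def total_on_def by blast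
    then show False using lt[OF p] ne that(4) by (metis less_irrefl)
  qed
  then have "inj_on (\<lambda>u. (P u, h u)) (sphere 0 1)" by (auto intro!: inj_onI)
  moreover have "continuous_on (sphere 0 1) (\<lambda>u. (P u, h u))"
    using P h unfolding n_crossing_knot_projection_def by (intro continuous_on_Pair) auto
  ultimately show ?thesis
    unfolding K by (intro homeomorphic_compact[where f = "\<lambda>u. (P u, h u)"]) auto
qed

end

theory Submission
  imports Defs
begin

text \<open>
  The crossing data are descending: the finitely many parameters of strands through crossings are
  moved by a homeomorphism of the circle into the right half circle, and then strands are ordered by
  imaginary part. Two lifts of the projection whose heights are ordered alike over every point of the
  plane are isotopic by a vertical isotopy, so the height may be taken to be the imaginary part itself.
  Then every level \<open>s\<close> strictly between the extreme ones meets the knot in exactly two points. A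
  horizontal shear centres them at the origin, and a rotation and dilation of each level moves them
  to \<open>(\<plusminus>sqrt (1 - s\<^sup>2), s)\<close>, which gives a round circle.
\<close>

section \<open>Ambient isotopies\<close>

text \<open>A solution of \<open>f x = y\<close> is a fixed point of \<open>x - f x + y\<close>,
  which maps the ball of radius \<open>B\<close> about \<open>y\<close> into itself, so Brouwer's
  theorem yields one.\<close>

lemma surj_of_bounded_displacement:
  fixes f :: "'a::euclidean_space \<Rightarrow> 'a"
  assumes "continuous_on UNIV f" and "\<And>x. dist (f x) x \<le> B"
  shows "surj f"
proof -
  have "\<exists>x. f x = y" for y
  proof -
    have "0 \<le> B" using assms(2)[of y] zero_le_dist order_trans by blast
    moreover have "continuous_on (cball y B) (\<lambda>x. x - f x + y)"
      by (intro continuous_intros continuous_on_subset[OF assms(1)]) auto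
    moreover have "(\<lambda>x. x - f x + y) \<in> cball y B \<rightarrow> cball y B"
      using assms(2) by (auto simp: dist_norm norm_minus_commute)
    ultimately obtain x where "x - f x + y = x"
      using brouwer[of "cball y B" "\<lambda>x. x - f x + y"] by auto
    then show ?thesis by (intro exI[of _ x]) (simp add: algebra_simps)
  qed
  then show ?thesis by (metis surjI)
qed

text \<open>No inverse has to be exhibited: bounded displacement makes each stage surjective, and
  invariance of domain makes a continuous bijection of space a homeomorphism. Every isotopy written
  down by a formula below enters through this criterion.\<close>

lemma ambient_isotopicI:
  fixes H :: "real \<times> (complex \<times> real) \<Rightarrow> complex \<times> real"
  assumes cont: "continuous_on ({0..1} \<times> UNIV) H" and H0: "\<And>x. H (0, x) = x"
    and inj: "\<And>t. t \<in> {0..1} \<Longrightarrow> inj (\<lambda>x. H (t, x))"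
    and bd: "\<And>t x. t \<in> {0..1} \<Longrightarrow> dist (H (t, x)) x \<le> B"
    and L: "(\<lambda>x. H (1, x)) ` K = L"
  shows "ambient_isotopic K L"
proof -
  have hom: "\<exists>g. homeomorphism UNIV UNIV (\<lambda>x. H (t, x)) g" if t: "t \<in> {0..1}" for t
  proof -
    have c: "continuous_on UNIV (\<lambda>x. H (t, x))"
      by (rule continuous_on_compose2[OF cont]) (use t in \<open>auto intro!: continuous_intros\<close>)
    have "range (\<lambda>x. H (t, x)) = UNIV"
      using surj_of_bounded_displacement[OF c] bd[OF t] by auto
    then show ?thesis
      using invariance_of_domain_homeomorphism[OF open_UNIV c order_refl inj[OF t]] by metis
  qed
  have "continuous_map (prod_topology (top_of_set {0..1}) (top_of_set UNIV)) (top_of_set UNIV) H"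
    unfolding prod_topology_subtopology_eu using cont by simp
  then have "homotopic_with_canon (\<lambda>f. \<exists>g. homeomorphism UNIV UNIV f g) UNIV UNIV id (\<lambda>x. H (1, x))"
    unfolding homotopic_with_def by (intro exI[of _ H]) (use H0 hom in auto)
  then show ?thesis using L unfolding ambient_isotopic_def by blast
qed

lemma ambient_isotopic_trans [trans]:
  assumes "ambient_isotopic K L" and "ambient_isotopic L M"
  shows "ambient_isotopic K M"
proof -
  let ?h = "\<lambda>f. \<exists>g. homeomorphism UNIV UNIV f (g :: complex \<times> real \<Rightarrow> complex \<times> real)"
  obtain F G where F: "homotopic_with_canon ?h UNIV UNIV id F" "F ` K = L"
    and G: "homotopic_with_canon ?h UNIV UNIV id G" "G ` L = M"
    using assms unfolding ambient_isotopic_def by auto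
  have hG: "?h G" using homotopic_with_imp_property[OF G(1)] by blast
  \<comment> \<open>Postcomposing the first isotopy with \<open>G\<close> leads from
    \<open>G\<close> to \<open>G \<circ> F\<close>; it is appended to the isotopy from
    \<open>id\<close> to \<open>G\<close>.\<close>
  have "homotopic_with_canon ?h UNIV UNIV (G \<circ> id) (G \<circ> F)"
  proof (rule homotopic_with_compose_continuous_map_left[OF F(1)])
    show "continuous_map (top_of_set UNIV) (top_of_set UNIV) G"
      using hG by (auto simp: homeomorphism_def)
    show "?h (G \<circ> j)" if "?h j" for j using that hG homeomorphism_compose by blast
  qed
  then have "homotopic_with_canon ?h UNIV UNIV id (G \<circ> F)"
    using homotopic_with_trans[OF G(1)] by simp
  moreover have "(G \<circ> F) ` K = M" unfolding G(2)[symmetric] F(2)[symmetric] image_comp ..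
  ultimately show ?thesis unfolding ambient_isotopic_def by blast
qed

text \<open>Postcomposing the isotopy from \<open>id\<close> to \<open>F\<close> with the inverse
  \<open>G\<close> of \<open>F\<close> gives one from \<open>G\<close> to \<open>id\<close>, which
  is then reversed in time.\<close>

lemma ambient_isotopic_sym:
  assumes "ambient_isotopic K L"
  shows "ambient_isotopic L K"
proof -
  let ?h = "\<lambda>f. \<exists>g. homeomorphism UNIV UNIV f (g :: complex \<times> real \<Rightarrow> complex \<times> real)"
  obtain F where F: "homotopic_with_canon ?h UNIV UNIV id F" "F ` K = L"
    using assms unfolding ambient_isotopic_def by auto
  obtain G where G: "homeomorphism UNIV UNIV F G"
    using homotopic_with_imp_property[OF F(1)] by blast
  then have GF: "G \<circ> F = id" by (auto simp: homeomorphism_def)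
  have "homotopic_with_canon ?h UNIV UNIV (G \<circ> id) (G \<circ> F)"
  proof (rule homotopic_with_compose_continuous_map_left[OF F(1)])
    show "continuous_map (top_of_set UNIV) (top_of_set UNIV) G"
      using G by (auto simp: homeomorphism_def)
    show "?h (G \<circ> j)" if "?h j" for j using that G homeomorphism_compose homeomorphism_symD by blast
  qed
  then have "homotopic_with_canon ?h UNIV UNIV id G"
    unfolding GF by (simp add: homotopic_with_sym)
  moreover have "G ` L = K" unfolding F(2)[symmetric] image_comp GF by simp
  ultimately show ?thesis unfolding ambient_isotopic_def by blast
qed

section \<open>Monotone extension and change of height\<close>

text \<open>On the compact set of pairs with \<open>k u - k v \<ge> e\<close> the one-sided distance
  cannot vanish, since a zero would force \<open>P u = P v\<close> and \<open>h u \<le> h v\<close>,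
  hence \<open>k u \<le> k v\<close>. It thus has a positive minimum there, and a large slope
  absorbs the oscillation of \<open>k\<close>.\<close>

lemma lipschitz_up_to_error:
  fixes P :: "'a::metric_space \<Rightarrow> 'b::metric_space" and h k :: "'a \<Rightarrow> real"
  assumes X: "compact X" and P: "continuous_on X P" and h: "continuous_on X h" and k: "continuous_on X k"
    and mono: "\<And>u v. \<lbrakk>u \<in> X; v \<in> X; P u = P v; h u \<le> h v\<rbrakk> \<Longrightarrow> k u \<le> k v"
    and e: "e > 0"
  shows "\<exists>C\<ge>0. \<forall>u\<in>X. \<forall>v\<in>X. k u - k v \<le> e + C * (dist (P v) (P u) + max 0 (h u - h v))"
proof -
  define d where "d w = dist (P (snd w)) (P (fst w)) + max 0 (h (fst w) - h (snd w))" for w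
  define T where "T = {w \<in> X \<times> X. k (fst w) - k (snd w) \<in> {e..}}"
  have "continuous_on (X \<times> X) (\<lambda>w. k (fst w) - k (snd w))"
    by (intro continuous_intros continuous_on_compose2[OF k]) auto
  then have "closedin (top_of_set (X \<times> X)) T"
    using continuous_closedin_preimage[of "X \<times> X" _ "{e..}"] by (simp add: T_def vimage_def Int_def)
  then have T: "compact T" using X closedin_compact compact_Times by blast
  have k_bd: "bounded (k ` X)" using X k compact_continuous_image compact_imp_bounded by blast
  then obtain B where B: "\<And>u. u \<in> X \<Longrightarrow> \<bar>k u\<bar> \<le> B"
    unfolding bounded_iff by auto
  have dc: "continuous_on T d"
    unfolding d_def
    by (intro continuous_intros continuous_on_compose2[OF P] continuous_on_compose2[OF h]) (auto simp: T_def)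
  have d0: "0 \<le> d w" for w by (simp add: d_def)
  show ?thesis
  proof (cases "T = {}")
    case True
    then have "k u - k v < e" if "u \<in> X" "v \<in> X" for u v
      using that unfolding T_def by force
    then show ?thesis by (intro exI[of _ 0]) (auto intro: less_imp_le)
  next
    case False
    obtain w0 where w0: "w0 \<in> T" "\<And>w. w \<in> T \<Longrightarrow> d w0 \<le> d w"
      using continuous_attains_inf[OF T False dc] by blast
    have pos: "d w0 > 0"
    proof (rule ccontr)
      assume "\<not> d w0 > 0"
      then have "d w0 = 0" using d0[of w0] by simp
      then have "P (fst w0) = P (snd w0)" "h (fst w0) \<le> h (snd w0)"
        unfolding d_def by (auto simp: add_nonneg_eq_0_iff)
      then show False using mono[of "fst w0" "snd w0"] w0(1) e by (auto simp: T_def)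
    qed
    \<comment> \<open>With this slope, \<open>C\<close> times the minimal distance
      \<open>d w0\<close> is \<open>2 * \<bar>B\<bar>\<close>, a bound for every difference of
      values of \<open>k\<close>.\<close>
    define C where "C = 2 * \<bar>B\<bar> / d w0"
    have C: "C \<ge> 0" using pos by (simp add: C_def)
    have "k u - k v \<le> e + C * d (u, v)" if uv: "u \<in> X" "v \<in> X" for u v
    proof (cases "(u, v) \<in> T")
      case True
      have "2 * \<bar>B\<bar> = C * d w0" using pos by (simp add: C_def)
      also have "\<dots> \<le> C * d (u, v)" using w0(2)[OF True] C by (rule mult_left_mono)
      finally show ?thesis using B[OF uv(1)] B[OF uv(2)] e by linarith
    next
      case False
      then have "k u - k v < e" using uv by (auto simp: T_def)
      then show ?thesis using C d0[of "(u, v)"] by (smt (verit) mult_nonneg_nonneg)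
    qed
    then show ?thesis using C by (intro exI[of _ C]) (auto simp: d_def)
  qed
qed

text \<open>The affine bounds with errors \<open>1 / (n + 1)\<close> are combined into one
  subadditive modulus of continuity. Only the excess of \<open>h u\<close> over \<open>h v\<close>
  counts as vertical distance, so the last estimate encodes the monotonicity of \<open>k\<close> in
  the height as well as its continuity.\<close>

lemma modulus_exists:
  fixes P :: "'a::metric_space \<Rightarrow> 'b::metric_space" and h k :: "'a \<Rightarrow> real"
  assumes "compact X" and "continuous_on X P" and "continuous_on X h" and "continuous_on X k"
    and "\<And>u v. \<lbrakk>u \<in> X; v \<in> X; P u = P v; h u \<le> h v\<rbrakk> \<Longrightarrow> k u \<le> k v"
  obtains w :: "real \<Rightarrow> real" where "\<And>t. t \<ge> 0 \<Longrightarrow> w t \<ge> 0" and "w 0 = 0"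
    and "\<And>s t. \<lbrakk>0 \<le> s; s \<le> t\<rbrakk> \<Longrightarrow> w s \<le> w t"
    and "\<And>s t. \<lbrakk>0 \<le> s; 0 \<le> t\<rbrakk> \<Longrightarrow> w (s + t) \<le> w s + w t"
    and "\<And>e. e > 0 \<Longrightarrow> \<exists>d>0. \<forall>t. 0 \<le> t \<and> t < d \<longrightarrow> w t < e"
    and "\<And>u v. \<lbrakk>u \<in> X; v \<in> X\<rbrakk> \<Longrightarrow> k u - k v \<le> w (dist (P v) (P u) + max 0 (h u - h v))"
proof -
  have "\<forall>n. \<exists>C\<ge>0. \<forall>u\<in>X. \<forall>v\<in>X.
      k u - k v \<le> inverse (real (Suc n)) + C * (dist (P v) (P u) + max 0 (h u - h v))"
    by (intro allI lipschitz_up_to_error assms) auto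
  then obtain C where C0: "\<And>n. C n \<ge> 0" and C: "\<And>n u v. \<lbrakk>u \<in> X; v \<in> X\<rbrakk> \<Longrightarrow>
      k u - k v \<le> inverse (real (Suc n)) + C n * (dist (P v) (P u) + max 0 (h u - h v))"
    by metis
  \<comment> \<open>For an infimum of affine functions with nonnegative coefficients, subadditivity is automatic:
    bound \<open>w (s + t)\<close> by whichever of the two chosen functions has the smaller slope.\<close>
  define w where "w t = (INF n. inverse (real (Suc n)) + C n * t)" for t
  have bdd: "bdd_below (range (\<lambda>n. inverse (real (Suc n)) + C n * t))" if "t \<ge> 0" for t
    using that C0 by (intro bdd_belowI[of _ 0]) auto
  have le: "w t \<le> inverse (real (Suc n)) + C n * t" if "t \<ge> 0" for t n
    unfolding w_def using bdd[OF that] by (rule cINF_lower) simp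
  have ge: "a \<le> w t" if "\<And>n. a \<le> inverse (real (Suc n)) + C n * t" for a t
    unfolding w_def by (rule cINF_greatest) (use that in auto)
  have w0: "w t \<ge> 0" if "t \<ge> 0" for t by (rule ge) (use that C0 in auto)
  have small: "\<exists>d>0. \<forall>t. 0 \<le> t \<and> t < d \<longrightarrow> w t < e" if e: "e > 0" for e
  proof -
    obtain n where n: "inverse (real (Suc n)) < e" using reals_Archimedean[OF e] by auto
    \<comment> \<open>The linear term may use up what the error of the \<open>n\<close>-th bound
      leaves of \<open>e\<close>; the \<open>+ 1\<close> keeps the denominator positive when the
      slope is 0.\<close>
    define d where "d = (e - inverse (real (Suc n))) / (C n + 1)"
    have "C n * t < e - inverse (real (Suc n))" if t: "0 \<le> t" "t < d" for t
    proof -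
      have "C n * t \<le> (C n + 1) * t" using t by (simp add: algebra_simps)
      also have "\<dots> < (C n + 1) * d" using t C0[of n] by (intro mult_strict_left_mono) auto
      also have "\<dots> = e - inverse (real (Suc n))" using C0[of n] by (simp add: d_def)
      finally show ?thesis .
    qed
    then have "w t < e" if "0 \<le> t" "t < d" for t using le[OF that(1), of n] that by fastforce
    moreover have "d > 0" using n C0[of n] by (simp add: d_def)
    ultimately show ?thesis by blast
  qed
  show thesis
  proof
    show "w t \<ge> 0" if "t \<ge> 0" for t by (rule w0[OF that])
    show "w 0 = 0"
    proof (rule ccontr)
      assume "w 0 \<noteq> 0"
      then have "w 0 > 0" using w0[of 0] by simp
      then show False using small[of "w 0"] by auto
    qed
    show "w s \<le> w t" if st: "0 \<le> s" "s \<le> t" for s t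
    proof (rule ge)
      fix n
      show "w s \<le> inverse (real (Suc n)) + C n * t"
        using le[OF st(1), of n] mult_left_mono[OF st(2) C0[of n]] by linarith
    qed
    show "w (s + t) \<le> w s + w t" if st: "0 \<le> s" "0 \<le> t" for s t
    proof -
      have "w (s + t) \<le> (inverse (real (Suc m)) + C m * s) + (inverse (real (Suc n)) + C n * t)" for m n
      proof (cases "C m \<le> C n")
        case True
        have "C m * t \<le> C n * t" using True st by (intro mult_right_mono)
        moreover have "0 < inverse (real (Suc n))" by simp
        ultimately show ?thesis using le[of "s + t" m] st unfolding distrib_left by linarith
      next
        case False
        then have "C n * s \<le> C m * s" using st by (intro mult_right_mono) auto
        moreover have "0 < inverse (real (Suc m))" by simp
        ultimately show ?thesis using le[of "s + t" n] st unfolding distrib_left by linarith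
      qed
      \<comment> \<open>As the bound holds for independent indices, the two infima are taken one
        after the other.\<close>
      then have "w (s + t) - (inverse (real (Suc m)) + C m * s) \<le> w t" for m
        by (intro ge) (smt (verit))
      then have "w (s + t) - w t \<le> w s" by (intro ge) (smt (verit))
      then show ?thesis by simp
    qed
    show "\<exists>d>0. \<forall>t. 0 \<le> t \<and> t < d \<longrightarrow> w t < e" if "e > 0" for e by (rule small[OF that])
    show "k u - k v \<le> w (dist (P v) (P u) + max 0 (h u - h v))" if "u \<in> X" "v \<in> X" for u v
      by (rule ge, rule C[OF that])
  qed
qed

text \<open>This is the McShane-Whitney extension, the supremum of \<open>k u - w (d x u)\<close>,
  with a distance \<open>d\<close> that charges only for the height of \<open>u\<close> above
  \<open>x\<close>. Raising \<open>x\<close> decreases \<open>d\<close>, so the extension is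
  monotone in the height.\<close>

lemma monotone_extension:
  fixes P :: "'a::metric_space \<Rightarrow> 'b::metric_space" and h k :: "'a \<Rightarrow> real"
  assumes X: "compact X" and P: "continuous_on X P" and h: "continuous_on X h" and k: "continuous_on X k"
    and mono: "\<And>u v. \<lbrakk>u \<in> X; v \<in> X; P u = P v; h u \<le> h v\<rbrakk> \<Longrightarrow> k u \<le> k v"
  obtains f :: "'b \<times> real \<Rightarrow> real" and B where "continuous_on UNIV f"
    and "\<And>z r s. r \<le> s \<Longrightarrow> f (z, r) \<le> f (z, s)"
    and "\<And>u. u \<in> X \<Longrightarrow> f (P u, h u) = k u" and "\<And>x. \<bar>f x\<bar> \<le> B"
proof (cases "X = {}")
  case True
  show thesis by (rule that[of "\<lambda>_. 0" 0]) (use True in auto)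
next
  case False
  obtain w :: "real \<Rightarrow> real" where w_nonneg: "\<And>t. t \<ge> 0 \<Longrightarrow> w t \<ge> 0" and w0: "w 0 = 0"
    and w_mono: "\<And>s t. \<lbrakk>0 \<le> s; s \<le> t\<rbrakk> \<Longrightarrow> w s \<le> w t"
    and w_add: "\<And>s t. \<lbrakk>0 \<le> s; 0 \<le> t\<rbrakk> \<Longrightarrow> w (s + t) \<le> w s + w t"
    and w_small: "\<And>e. e > 0 \<Longrightarrow> \<exists>d>0. \<forall>t. 0 \<le> t \<and> t < d \<longrightarrow> w t < e"
    and w_k: "\<And>u v. \<lbrakk>u \<in> X; v \<in> X\<rbrakk> \<Longrightarrow> k u - k v \<le> w (dist (P v) (P u) + max 0 (h u - h v))"
    by (rule modulus_exists[OF X P h k]) ((rule mono; assumption), (rule that; assumption))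
  have "bounded (k ` X)" using X k compact_continuous_image compact_imp_bounded by blast
  then obtain B where B: "\<And>u. u \<in> X \<Longrightarrow> \<bar>k u\<bar> \<le> B" unfolding bounded_iff by auto
  define d where "d x u = dist (fst x) (P u) + max 0 (h u - snd x)" for x u
  define g where "g x = (SUP u\<in>X. k u - w (d x u))" for x
  have d0: "0 \<le> d x u" for x u by (simp add: d_def)
  have bdd: "bdd_above ((\<lambda>u. k u - w (d x u)) ` X)" for x
    by (intro bdd_aboveI2[of _ _ B]) (smt (verit) B w_nonneg d0)
  have g_ge: "k u - w (d x u) \<le> g x" if "u \<in> X" for u x
    unfolding g_def using that bdd by (rule cSUP_upper)
  have g_le: "g x \<le> a" if "\<And>u. u \<in> X \<Longrightarrow> k u - w (d x u) \<le> a" for x a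
    unfolding g_def using False that by (rule cSUP_least)
  have g_le_B: "g x \<le> B" for x by (rule g_le) (smt (verit) B w_nonneg d0)
  \<comment> \<open>By the triangle inequality and subadditivity, \<open>w\<close> is also a modulus
    of continuity for \<open>g\<close>.\<close>
  have g_diff: "g y \<le> g x + w (dist (fst x) (fst y) + \<bar>snd x - snd y\<bar>)" for x y
  proof (rule g_le)
    fix u assume u: "u \<in> X"
    let ?e = "dist (fst x) (fst y) + \<bar>snd x - snd y\<bar>"
    have "dist (fst x) (P u) \<le> dist (fst y) (P u) + dist (fst x) (fst y)"
      by (metis add.commute dist_triangle)
    then have "d x u \<le> d y u + ?e" unfolding d_def by linarith
    then have "w (d x u) \<le> w (d y u + ?e)" by (rule w_mono[OF d0])
    also have "\<dots> \<le> w (d y u) + w ?e" by (rule w_add) (use d0 in auto)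
    finally show "k u - w (d y u) \<le> g x + w ?e" using g_ge[OF u, of x] by linarith
  qed
  have cont: "continuous_on UNIV g"
    unfolding continuous_on_iff
  proof (intro ballI allI impI)
    fix x and e :: real assume "e > 0"
    then obtain c where c: "c > 0" "\<And>t. 0 \<le> t \<Longrightarrow> t < c \<Longrightarrow> w t < e" using w_small by blast
    have "dist (g y) (g x) < e" if "dist y x < c / 2" for y
    proof -
      let ?t = "dist (fst x) (fst y) + \<bar>snd x - snd y\<bar>"
      have "dist (fst x) (fst y) < c / 2" "\<bar>snd x - snd y\<bar> < c / 2"
        using that dist_fst_le[of x y] dist_snd_le[of x y] by (auto simp: dist_commute dist_real_def)
      then have "w ?t < e" by (intro c(2)) auto
      moreover have "g y \<le> g x + w ?t" "g x \<le> g y + w ?t"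
        using g_diff[of y x] g_diff[of x y] by (simp_all add: dist_commute abs_minus_commute)
      ultimately show ?thesis by (simp add: dist_real_def)
    qed
    then show "\<exists>d>0. \<forall>y\<in>UNIV. dist y x < d \<longrightarrow> dist (g y) (g x) < e"
      using c(1) by (intro exI[of _ "c / 2"]) auto
  qed
  have g_mono: "g (z, r) \<le> g (z, s)" if "r \<le> s" for z r s
  proof (rule g_le)
    fix u assume u: "u \<in> X"
    have "d (z, s) u \<le> d (z, r) u" using that by (simp add: d_def)
    then have "w (d (z, s) u) \<le> w (d (z, r) u)" by (rule w_mono[OF d0])
    then show "k u - w (d (z, r) u) \<le> g (z, s)" using g_ge[OF u, of "(z, s)"] by linarith
  qed
  have g_eq: "g (P v, h v) = k v" if v: "v \<in> X" for v
  proof (rule antisym)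
    show "g (P v, h v) \<le> k v"
    proof (rule g_le)
      fix u assume u: "u \<in> X"
      show "k u - w (d (P v, h v) u) \<le> k v" using w_k[OF u v] by (simp add: d_def)
    qed
    show "k v \<le> g (P v, h v)" using g_ge[OF v, of "(P v, h v)"] w0 by (simp add: d_def)
  qed
  show thesis
  \<comment> \<open>\<open>g\<close> is at most \<open>B\<close> but may be unbounded below far from
    the curve. Truncating at \<open>- B\<close> does not affect the prescribed values, which lie
    between \<open>- B\<close> and \<open>B\<close>.\<close>
  proof (rule that[of "\<lambda>x. max (- B) (g x)" "\<bar>B\<bar>"])
    show "continuous_on UNIV (\<lambda>x. max (- B) (g x))" using cont by (intro continuous_intros)
    show "max (- B) (g (z, r)) \<le> max (- B) (g (z, s))" if "r \<le> s" for z r s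
      using g_mono[OF that, of z] by linarith
    show "max (- B) (g (P u, h u)) = k u" if "u \<in> X" for u using g_eq[OF that] B[OF that] by simp
    show "\<bar>max (- B) (g x)\<bar> \<le> \<bar>B\<bar>" for x using g_le_B[of x] by linarith
  qed
qed

text \<open>Points move along vertical lines by \<open>t * f\<close>, where \<open>f\<close> is the
  bounded monotone extension of \<open>k\<close>. For \<open>t \<ge> 0\<close>, adding a
  nondecreasing function to the height keeps distinct points of a vertical line distinct.\<close>

lemma ambient_isotopic_add_height:
  fixes P :: "'a::metric_space \<Rightarrow> complex" and h k :: "'a \<Rightarrow> real"
  assumes "compact X" and "continuous_on X P" and "continuous_on X h" and "continuous_on X k"
    and "\<And>u v. \<lbrakk>u \<in> X; v \<in> X; P u = P v; h u \<le> h v\<rbrakk> \<Longrightarrow> k u \<le> k v"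
  shows "ambient_isotopic ((\<lambda>u. (P u, h u)) ` X) ((\<lambda>u. (P u, h u + k u)) ` X)"
proof -
  obtain f :: "complex \<times> real \<Rightarrow> real" and B where f: "continuous_on UNIV f"
    and f_mono: "\<And>z r s. r \<le> s \<Longrightarrow> f (z, r) \<le> f (z, s)"
    and f_eq: "\<And>u. u \<in> X \<Longrightarrow> f (P u, h u) = k u" and B: "\<And>x. \<bar>f x\<bar> \<le> B"
    by (rule monotone_extension[OF assms(1-4)]) ((rule assms(5); assumption), (rule that; assumption))
  define H where "H = (\<lambda>(t, z, s). (z :: complex, s + t * f (z, s)))"
  show ?thesis
  proof (rule ambient_isotopicI[of H B])
    show "continuous_on ({0..1} \<times> UNIV) H"
      unfolding H_def case_prod_unfold
      by (intro continuous_intros continuous_on_compose2[OF f]) auto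
    show "H (0, x) = x" for x by (simp add: H_def case_prod_unfold)
    fix t :: real assume t: "t \<in> {0..1}"
    have lt: "r + t * f (z, r) < s + t * f (z, s)" if "r < s" for z r s
      using mult_left_mono[OF f_mono[of r s z], of t] that t by simp
    show "inj (\<lambda>x. H (t, x))"
    proof (rule injI)
      fix x y assume "H (t, x) = H (t, y)"
      then show "x = y"
        using lt[of "snd x" "snd y" "fst x"] lt[of "snd y" "snd x" "fst x"]
        by (cases x; cases y; cases "snd x" "snd y" rule: linorder_cases) (auto simp: H_def)
    qed
    show "dist (H (t, x)) x \<le> B" for x
    proof -
      have "\<bar>t * f x\<bar> \<le> 1 * B" unfolding abs_mult using t B[of x] by (intro mult_mono) auto
      then show ?thesis by (cases x) (simp add: H_def dist_Pair_Pair dist_real_def)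
    qed
  next
    show "(\<lambda>x. H (1, x)) ` (\<lambda>u. (P u, h u)) ` X = (\<lambda>u. (P u, h u + k u)) ` X"
      unfolding image_image by (intro image_cong) (auto simp: H_def f_eq)
  qed
qed

text \<open>
  The extension \<open>f\<close> of \<open>k\<close> is only weakly increasing in the height, so \<open>(z, s) \<mapsto> (z, f (z, s))\<close> need not
  be injective, but \<open>(z, s) \<mapsto> (z, s + f (z, s))\<close> is. Hence the detour through the heights \<open>h + k\<close>.
\<close>

lemma ambient_isotopic_change_height:
  fixes P :: "'a::metric_space \<Rightarrow> complex" and h k :: "'a \<Rightarrow> real"
  assumes "compact X" and "continuous_on X P" and "continuous_on X h" and "continuous_on X k"
    and "\<And>u v. \<lbrakk>u \<in> X; v \<in> X; P u = P v\<rbrakk> \<Longrightarrow> h u \<le> h v \<longleftrightarrow> k u \<le> k v"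
  shows "ambient_isotopic ((\<lambda>u. (P u, h u)) ` X) ((\<lambda>u. (P u, k u)) ` X)"
proof -
  have hk: "ambient_isotopic ((\<lambda>u. (P u, h u)) ` X) ((\<lambda>u. (P u, h u + k u)) ` X)"
    by (rule ambient_isotopic_add_height) (use assms in auto)
  have "ambient_isotopic ((\<lambda>u. (P u, k u)) ` X) ((\<lambda>u. (P u, k u + h u)) ` X)"
    by (rule ambient_isotopic_add_height) (use assms in auto)
  then have "ambient_isotopic ((\<lambda>u. (P u, k u)) ` X) ((\<lambda>u. (P u, h u + k u)) ` X)"
    by (simp only: add.commute)
  then show ?thesis by (rule ambient_isotopic_trans[OF hk ambient_isotopic_sym])
qed

section \<open>Curves meeting every level in two points\<close>

lemma ambient_isotopic_shear:
  fixes c :: "real \<Rightarrow> complex"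
  assumes c: "continuous_on {a..b} c" and K: "\<And>x. x \<in> K \<Longrightarrow> snd x \<in> {a..b}"
  shows "ambient_isotopic K ((\<lambda>x. (fst x + c (snd x), snd x)) ` K)"
proof (cases "a \<le> b")
  case False
  then have "K = {}" using K by force
  then show ?thesis by (intro ambient_isotopicI[of snd 0]) (auto intro!: continuous_intros)
next
  case True
  \<comment> \<open>Beyond \<open>{a..b}\<close> the translation is continued by its end values, so
    it stays continuous and bounded on all levels.\<close>
  define p where "p s = c (max a (min b s))" for s
  have p: "continuous_on UNIV p"
    unfolding p_def using True by (intro continuous_on_compose2[OF c] continuous_intros) auto
  have "bounded (c ` {a..b})" using c compact_continuous_image compact_imp_bounded by blast
  then obtain B where "\<And>s. s \<in> {a..b} \<Longrightarrow> norm (c s) \<le> B" unfolding bounded_iff by blast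
  then have B: "norm (p s) \<le> B" for s using True by (simp add: p_def)
  define H where "H = (\<lambda>(t :: real, z, s). (z + of_real t * p s, s))"
  show ?thesis
  proof (rule ambient_isotopicI[of H B])
    show "continuous_on ({0..1} \<times> UNIV) H"
      unfolding H_def case_prod_unfold
      by (intro continuous_intros continuous_on_compose2[OF p]) auto
    show "H (0, x) = x" for x by (simp add: H_def case_prod_unfold)
    fix t :: real assume t: "t \<in> {0..1}"
    show "inj (\<lambda>x. H (t, x))" by (auto simp: H_def inj_on_def)
    show "dist (H (t, x)) x \<le> B" for x
    proof -
      have "t * norm (p (snd x)) \<le> 1 * B" using t B[of "snd x"] by (intro mult_mono) auto
      then show ?thesis using t by (cases x) (simp add: H_def dist_Pair_Pair dist_norm norm_mult)
    qed
  next
    show "(\<lambda>x. H (1, x)) ` K = (\<lambda>x. (fst x + c (snd x), snd x)) ` K"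
      by (intro image_cong) (use K in \<open>auto simp: H_def p_def case_prod_unfold\<close>)
  qed
qed

text \<open>The radius function is linear with factor \<open>(c + q) / c\<close> up to
  \<open>c\<close> and the shift by \<open>q\<close> from there on. It takes \<open>c\<close> to
  \<open>c + q\<close> and moves every nonnegative radius by at most \<open>\<bar>q\<bar>\<close>,
  which allows a level to be dilated with bounded displacement.\<close>

lemma radial_stretch_less:
  fixes r r' c q :: real
  assumes "r < r'" and "c > 0" and "c + q > 0"
  shows "r * (1 + q / max r c) < r' * (1 + q / max r' c)"
proof -
  have pos: "1 + q / c > 0" using assms by (simp add: field_simps)
  consider "r' \<le> c" | "c \<le> r" | "r < c" "c < r'" using assms(1) by linarith
  then show ?thesis
  proof cases
    case 1
    then show ?thesis using assms pos by (simp add: max_absorb2)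
  next
    case 2
    then show ?thesis using assms by (simp add: max_absorb1 distrib_left)
  next
    case 3
    have "r * (1 + q / c) < c * (1 + q / c)" using 3 pos by (intro mult_strict_right_mono)
    also have "\<dots> < r' * (1 + q / r')" using 3 assms by (simp add: distrib_left)
    finally show ?thesis using 3 by simp
  qed
qed

text \<open>
  The argument of \<open>d s\<close> may be unbounded as \<open>s\<close> tends to \<open>a\<close> or \<open>b\<close> (the curve may spiral into its
  extreme points), so rotating whole levels would be discontinuous there. The rotation is therefore
  damped to zero between the radii \<open>norm (d s)\<close> and \<open>2 * norm (d s)\<close>.
\<close>

lemma ambient_isotopic_rotate_scale:
  fixes d :: "real \<Rightarrow> complex" and e :: "real \<Rightarrow> real"
  assumes d: "continuous_on UNIV d" and e: "continuous_on UNIV e"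
    and d0: "\<And>s. d s \<noteq> 0 \<longleftrightarrow> s \<in> {a<..<b}" and e0: "\<And>s. s \<notin> {a<..<b} \<Longrightarrow> e s = 0"
    and e_pos: "\<And>s. s \<in> {a<..<b} \<Longrightarrow> e s > 0"
    and bd: "\<And>s. norm (d s) \<le> B" "\<And>s. \<bar>e s\<bar> \<le> B"
  shows "ambient_isotopic ((\<lambda>(\<sigma>, s). (of_real \<sigma> * d s, s)) ` ({-1, 1} \<times> S))
    ((\<lambda>(\<sigma>, s). (of_real (\<sigma> * e s), s)) ` ({-1, 1} \<times> S))"
proof -
  \<comment> \<open>\<open>Im (l s)\<close> is a continuous choice of the argument of
    \<open>d s\<close>; it exists because the interval is contractible and \<open>d\<close> has no
    zero on it.\<close>
  obtain l where l: "continuous_on {a<..<b} l" "\<And>s. s \<in> {a<..<b} \<Longrightarrow> d s = exp (l s)"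
    using continuous_logarithm_on_contractible[of "{a<..<b}" d] d0
      continuous_on_subset[OF d] convex_imp_contractible[of "{a<..<b}"] by (metis convex_real_interval(8) subset_UNIV)
  \<comment> \<open>\<open>norm (d s) + q t s\<close> interpolates linearly from
    \<open>norm (d s)\<close> to \<open>e s\<close>; the multiplier \<open>w\<close> depends on
    \<open>z\<close> only through its norm, so it rotates and dilates each circle about the
    origin.\<close>
  define q where "q t s = t * (e s - norm (d s))" for t s
  define c where "c s r = max 0 (min 1 (2 - r / norm (d s)))" for s r
  define w where "w t s r = cis (- (t * Im (l s) * c s r)) * of_real (1 + q t s / max r (norm (d s)))" for t s r
  define H where "H = (\<lambda>(t, z, s). (if d s = 0 then z else z * w t s (norm z), s))"
  define A where "A = {x :: real \<times> complex \<times> real. snd (snd x) \<in> {a<..<b}}"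
  have q_gt: "norm (d s) + q t s > 0" if "t \<in> {0..1}" "d s \<noteq> 0" for t s
  proof (cases "e s \<ge> norm (d s)")
    case True
    then have "q t s \<ge> 0" using that by (simp add: q_def)
    then show ?thesis using that by (simp add: add_pos_nonneg)
  next
    case False
    then have "1 * (e s - norm (d s)) \<le> t * (e s - norm (d s))" using that by (intro mult_right_mono_neg) auto
    then have "e s - norm (d s) \<le> q t s" by (simp add: q_def)
    moreover have "e s > 0" using that d0 e_pos by blast
    ultimately show ?thesis by linarith
  qed
  have norm_w: "norm (w t s r) = 1 + q t s / max r (norm (d s))" if "t \<in> {0..1}" "d s \<noteq> 0" for t s r
  proof -
    have m: "max r (norm (d s)) > 0" using that by (simp add: less_max_iff_disj)
    have "max r (norm (d s)) + q t s > 0" using q_gt[OF that] by linarith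
    then have "1 + q t s / max r (norm (d s)) > 0" using m by (simp add: field_simps)
    then show ?thesis unfolding w_def norm_mult norm_of_real by simp
  qed
  \<comment> \<open>Only points of norm below \<open>2 * norm (d s)\<close> are rotated, each moving
    by at most twice its norm; the dilation adds at most
    \<open>\<bar>e s - norm (d s)\<bar>\<close>. This bound serves both continuity at the extreme
    levels and bounded displacement.\<close>
  have displ: "norm (z * w t s (norm z) - z) \<le> 4 * norm (d s) + \<bar>e s - norm (d s)\<bar>"
    if t: "t \<in> {0..1}" and ds: "d s \<noteq> 0" for t s z
  proof -
    define v where "v = cis (- (t * Im (l s) * c s (norm z)))"
    have nv: "norm v = 1" by (simp add: v_def)
    have m: "max (norm z) (norm (d s)) > 0" using ds by (simp add: less_max_iff_disj)
    have 1: "norm (z * v - z) \<le> 4 * norm (d s)"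
    proof (cases "norm z \<ge> 2 * norm (d s)")
      case True
      then have "2 \<le> norm z / norm (d s)" using ds by (simp add: field_simps)
      then have "v = 1" by (simp add: v_def c_def)
      then show ?thesis by simp
    next
      case False
      have "norm (z * v - z) \<le> norm (z * v) + norm z" by (rule norm_triangle_ineq4)
      then show ?thesis using False nv by (simp add: norm_mult)
    qed
    have "norm (z * v * of_real (q t s / max (norm z) (norm (d s)))) =
        (norm z / max (norm z) (norm (d s))) * (t * \<bar>e s - norm (d s)\<bar>)"
      using m t nv unfolding norm_mult norm_of_real by (simp add: q_def abs_mult)
    also have "\<dots> \<le> 1 * (1 * \<bar>e s - norm (d s)\<bar>)"
      using m t by (intro mult_mono) (auto simp: field_simps)
    finally have 2: "norm (z * v * of_real (q t s / max (norm z) (norm (d s)))) \<le> \<bar>e s - norm (d s)\<bar>" by simp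
    have "z * w t s (norm z) - z = (z * v - z) + z * v * of_real (q t s / max (norm z) (norm (d s)))"
      unfolding w_def v_def[symmetric] by (simp add: algebra_simps)
    also have "norm \<dots> \<le> 4 * norm (d s) + \<bar>e s - norm (d s)\<bar>"
      by (rule norm_triangle_mono[OF 1 2])
    finally show ?thesis .
  qed
  have displ_H: "norm (H x - snd x) \<le> 4 * norm (d (snd (snd x))) + \<bar>e (snd (snd x)) - norm (d (snd (snd x)))\<bar>"
    if "x \<in> {0..1} \<times> UNIV" for x
    using that displ[of "fst x" "snd (snd x)" "fst (snd x)"]
    by (cases x) (auto simp: H_def norm_Pair case_prod_unfold)
  show ?thesis
  proof (rule ambient_isotopicI[of H "6 * B"])
    have "A = UNIV \<times> UNIV \<times> {a<..<b}" by (auto simp: A_def)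
    then have A: "open A" by (simp add: open_Times)
    have "continuous_on A (\<lambda>(t, z, s). (z * w t s (norm z), s))"
    proof -
      have dd: "continuous_on A (\<lambda>x. d (snd (snd x)))" "continuous_on A (\<lambda>x. e (snd (snd x)))"
        "continuous_on A (\<lambda>x. l (snd (snd x)))"
        by (intro continuous_on_compose2[OF d] continuous_on_compose2[OF e] continuous_on_compose2[OF l(1)]
            continuous_intros; auto simp: A_def)+
      have nz: "d (snd (snd x)) \<noteq> 0" "max (norm (fst (snd x))) (norm (d (snd (snd x)))) \<noteq> 0" if "x \<in> A" for x
        using that d0[of "snd (snd x)"] by (auto simp: A_def max_def)
      show ?thesis
        unfolding case_prod_unfold w_def c_def q_def cis_conv_exp
        by (intro continuous_intros dd) (use nz in auto)
    qed
    moreover have "(\<lambda>(t, z, s). (z * w t s (norm z), s)) x = H x" if "x \<in> A" for x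
      using that d0[of "snd (snd x)"] by (auto simp: A_def H_def case_prod_unfold)
    ultimately have HA: "continuous_on A H" using continuous_on_cong[of A A _ H] by blast
    show "continuous_on ({0..1} \<times> UNIV) H"
      unfolding continuous_on_eq_continuous_within
    proof
      fix x :: "real \<times> complex \<times> real" assume x: "x \<in> {0..1} \<times> UNIV"
      show "continuous (at x within {0..1} \<times> UNIV) H"
      proof (cases "x \<in> A")
        case True
        then show ?thesis
          using HA A continuous_on_eq_continuous_at continuous_at_imp_continuous_at_within by blast
      next
        case False
        \<comment> \<open>Outside \<open>{a<..<b}\<close> the level is fixed, and the displacement
          bound is continuous and zero there, so it squeezes \<open>H y - snd y\<close> to
          0.\<close>
        let ?F = "at x within {0..1} \<times> UNIV"
        let ?g = "\<lambda>y :: real \<times> complex \<times> real. 4 * norm (d (snd (snd y))) + \<bar>e (snd (snd y)) - norm (d (snd (snd y)))\<bar>"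
        have 0: "d (snd (snd x)) = 0" "e (snd (snd x)) = 0"
          using False d0[of "snd (snd x)"] e0[of "snd (snd x)"] by (auto simp: A_def)
        have "continuous_on UNIV ?g"
          by (intro continuous_intros continuous_on_compose2[OF d] continuous_on_compose2[OF e]) auto
        then have "(?g \<longlongrightarrow> ?g x) ?F"
          using continuous_on_subset[of UNIV ?g "{0..1} \<times> UNIV"] x unfolding continuous_on_def by blast
        then have g: "(?g \<longlongrightarrow> 0) ?F" using 0 by simp
        have "((\<lambda>y. H y - snd y) \<longlongrightarrow> 0) ?F"
          by (rule Lim_null_comparison[OF _ g]) (use displ_H in \<open>auto simp: eventually_at_filter\<close>)
        then have "((\<lambda>y. (H y - snd y) + snd y) \<longlongrightarrow> 0 + snd x) ?F"
          by (intro tendsto_add tendsto_snd tendsto_ident_at)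
        moreover have "H x = snd x" using 0 by (simp add: H_def case_prod_unfold)
        ultimately show ?thesis by (simp add: continuous_within)
      qed
    qed
    show "H (0, x) = x" for x
      by (simp add: H_def w_def q_def case_prod_unfold)
    fix t :: real assume t: "t \<in> {0..1}"
    show "inj (\<lambda>x. H (t, x))"
    proof (rule injI)
      fix x y assume "H (t, x) = H (t, y)"
      then obtain z z' s where xy: "x = (z, s)" "y = (z', s)" and eq: "H (t, z, s) = H (t, z', s)"
        by (cases x; cases y) (auto simp: H_def)
      have "z = z'"
      proof (cases "d s = 0")
        case True
        then show ?thesis using eq by (simp add: H_def)
      next
        case False
        \<comment> \<open>Taking norms, strict radial monotonicity gives equal radii; the two
          multipliers then coincide and can be cancelled.\<close>
        then have eq': "z * w t s (norm z) = z' * w t s (norm z')" using eq by (simp add: H_def)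
        then have "norm z * (1 + q t s / max (norm z) (norm (d s))) =
            norm z' * (1 + q t s / max (norm z') (norm (d s)))"
          using norm_w[OF t False] by (metis norm_mult)
        then have n: "norm z = norm z'"
          using radial_stretch_less[of "norm z" "norm z'" "norm (d s)" "q t s"]
            radial_stretch_less[of "norm z'" "norm z" "norm (d s)" "q t s"] q_gt[OF t False] False
          by (cases "norm z" "norm z'" rule: linorder_cases) auto
        show ?thesis
        proof (cases "z' = 0")
          case True
          then show ?thesis using n by simp
        next
          case nz: False
          have "norm z' * (1 + q t s / max (norm z') (norm (d s))) > 0"
            using radial_stretch_less[of 0 "norm z'" "norm (d s)" "q t s"] q_gt[OF t False] False nz by simp
          then have "w t s (norm z') \<noteq> 0" using norm_w[OF t False, of "norm z'"] by auto
          then show ?thesis using eq' n by simp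
        qed
      qed
      then show "x = y" by (simp add: xy)
    qed
    show "dist (H (t, x)) x \<le> 6 * B" for x
    proof -
      have "norm (H (t, x) - x) \<le> 4 * norm (d (snd x)) + \<bar>e (snd x) - norm (d (snd x))\<bar>"
        using displ_H[of "(t, x)"] t by simp
      then show ?thesis using bd[of "snd x"] unfolding dist_norm by linarith
    qed
  next
    \<comment> \<open>At radius \<open>norm (d s)\<close> the damping factor is 1, so the full
      rotation by \<open>- Im (l s)\<close> carries \<open>d s\<close> to the positive real axis,
      and the dilation gives it length \<open>e s\<close>.\<close>
    have "H (1, of_real \<sigma> * d s, s) = (of_real (\<sigma> * e s), s)" if \<sigma>: "\<sigma> \<in> {-1, 1}" for \<sigma> s
    proof (cases "d s = 0")
      case True
      then show ?thesis using d0[of s] e0[of s] by (auto simp: H_def)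
    next
      case False
      have n: "norm (of_real \<sigma> * d s) = norm (d s)" using \<sigma> by (auto simp: norm_mult)
      have "d s = exp (l s)" using l(2) False d0 by blast
      then have "d s = of_real (norm (d s)) * cis (Im (l s))"
        by (metis exp_eq_polar norm_exp_eq_Re)
      then have "d s * cis (- Im (l s)) = of_real (norm (d s))"
        by (metis cis_mult cis_zero add.right_inverse mult.assoc mult.right_neutral)
      moreover have "1 + (e s - norm (d s)) / norm (d s) = e s / norm (d s)"
        using False by (simp add: field_simps)
      moreover have "w 1 s (norm (d s)) = cis (- Im (l s)) * of_real (1 + (e s - norm (d s)) / norm (d s))"
        using False by (simp add: w_def c_def q_def)
      ultimately have "d s * w 1 s (norm (d s)) = of_real (norm (d s)) * of_real (e s / norm (d s))"
        by (metis mult.assoc)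
      then have "d s * w 1 s (norm (d s)) = of_real (e s)" using False by simp
      then show ?thesis using False n by (simp add: H_def mult.assoc)
    qed
    then show "(\<lambda>x. H (1, x)) ` (\<lambda>(\<sigma>, s). (of_real \<sigma> * d s, s)) ` ({-1, 1} \<times> S) =
        (\<lambda>(\<sigma>, s). (of_real (\<sigma> * e s), s)) ` ({-1, 1} \<times> S)"
      unfolding image_image by (intro image_cong) auto
  qed
qed

section \<open>Unknotting a curve with two points on each intermediate level\<close>

lemma sphere_eq_image_heights:
  "sphere (0 :: complex) 1 = (\<lambda>(\<sigma>, s). Complex (\<sigma> * sqrt (1 - s\<^sup>2)) s) ` ({-1, 1} \<times> {-1..1})"
  (is "?S = ?g ` ?X")
proof
  show "?S \<subseteq> ?g ` ?X"
  proof
    fix u :: complex assume "u \<in> ?S"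
    then have u: "(Re u)\<^sup>2 + (Im u)\<^sup>2 = 1" by (simp add: cmod_def)
    have "\<bar>Im u\<bar> \<le> 1" using u by (metis abs_square_le_1 le_add_same_cancel2 zero_le_power2)
    moreover have "sqrt (1 - (Im u)\<^sup>2) = \<bar>Re u\<bar>" using u by (metis add_diff_cancel_right' real_sqrt_abs)
    ultimately have "u = ?g (if Re u < 0 then -1 else 1, Im u)" "\<bar>Im u\<bar> \<le> 1"
      by (auto simp: complex_eq_iff)
    then show "u \<in> ?g ` ?X" by (intro image_eqI[of _ _ "(if Re u < 0 then -1 else 1, Im u)"]) auto
  qed
  show "?g ` ?X \<subseteq> ?S"
  proof -
    have "s\<^sup>2 \<le> 1" if "s \<in> {-1..1}" for s :: real using that by (simp add: abs_square_le_1 abs_le_iff)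
    then show ?thesis by (auto simp: cmod_def)
  qed
qed

lemma trivial_knot_two_points_per_level:
  fixes Q :: "complex \<Rightarrow> complex"
  assumes Q: "continuous_on (sphere 0 1) Q"
    and inj: "\<And>u v. \<lbrakk>u \<in> sphere 0 1; v \<in> sphere 0 1; Im u = Im v; Q u = Q v\<rbrakk> \<Longrightarrow> u = v"
  shows "trivial_knot ((\<lambda>u. (Q u, Im u)) ` sphere 0 1)"
proof -
  let ?X = "{-1, 1} \<times> {-1..1} :: (real \<times> real) set"
  \<comment> \<open>Clamping the level makes the two points \<open>p 1 s\<close> and
    \<open>p (-1) s\<close>, their half difference \<open>d\<close> and their midpoint
    \<open>m\<close> continuous on the whole line.\<close>
  define c where "c s = max (-1) (min 1 s)" for s :: real
  define e where "e s = sqrt (1 - (c s)\<^sup>2)" for s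
  define p where "p \<sigma> s = Q (Complex (\<sigma> * e s) (c s))" for \<sigma> s
  define d where "d s = (p 1 s - p (-1) s) / 2" for s
  define m where "m s = (p 1 s + p (-1) s) / 2" for s
  have c_id: "c s = s" if "s \<in> {-1..1}" for s using that by (simp add: c_def)
  have c_range: "c s \<in> {-1..1}" for s by (simp add: c_def)
  have c_cont: "continuous_on UNIV c" unfolding c_def by (intro continuous_intros)
  have e_cont: "continuous_on UNIV e" unfolding e_def by (intro continuous_intros c_cont)
  have c_sq: "(c s)\<^sup>2 \<le> 1" for s using c_range[of s] by (simp add: abs_square_le_1 abs_le_iff)
  have e_sq: "(e s)\<^sup>2 = 1 - (c s)\<^sup>2" and e_ge: "e s \<ge> 0" for s using c_sq[of s] by (simp_all add: e_def)
  have in_sphere: "Complex (\<sigma> * e s) (c s) \<in> sphere 0 1" if "\<sigma> \<in> {-1, 1}" for \<sigma> s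
    using that e_sq[of s] by (auto simp: cmod_def power_mult_distrib)
  have p_cont: "continuous_on UNIV (p \<sigma>)" if "\<sigma> \<in> {-1, 1}" for \<sigma>
    unfolding p_def
    by (rule continuous_on_compose2[OF Q])
       (use in_sphere[OF that] in \<open>auto simp: Complex_eq intro!: continuous_intros c_cont e_cont\<close>)
  have d_cont: "continuous_on UNIV d" and m_cont: "continuous_on UNIV m"
    unfolding d_def m_def by (intro continuous_intros p_cont; simp)+
  have e0: "e s = 0" if "s \<notin> {-1<..<1}" for s
  proof -
    have "c s = 1 \<or> c s = -1" using that by (auto simp: c_def)
    then show ?thesis by (auto simp: e_def)
  qed
  have e_pos: "e s > 0" if "s \<in> {-1<..<1}" for s
  proof -
    have "s\<^sup>2 < 1" using that by (simp add: abs_square_less_1 abs_less_iff)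
    then show ?thesis using that by (simp add: e_def c_id)
  qed
  have d0: "d s \<noteq> 0 \<longleftrightarrow> s \<in> {-1<..<1}" for s
  proof (cases "s \<in> {-1<..<1}")
    case True
    have "Complex (1 * e s) (c s) \<noteq> Complex (-1 * e s) (c s)" using e_pos[OF True] by simp
    then have "p 1 s \<noteq> p (-1) s"
      using inj[OF in_sphere[of 1 s] in_sphere[of "-1" s]] by (auto simp: p_def)
    then show ?thesis using True by (simp add: d_def)
  next
    case False
    then show ?thesis using e0[OF False] unfolding d_def p_def by simp
  qed
  have "bounded (Q ` sphere 0 1)"
    by (intro compact_imp_bounded compact_continuous_image Q) simp
  then obtain B where B: "\<And>u. u \<in> sphere 0 1 \<Longrightarrow> norm (Q u) \<le> B"
    unfolding bounded_iff by blast
  have pB: "norm (p \<sigma> s) \<le> B" if "\<sigma> \<in> {-1, 1}" for \<sigma> s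
    unfolding p_def by (rule B[OF in_sphere[OF that]])
  have dB: "norm (d s) \<le> max B 1" for s
  proof -
    have "norm (p 1 s - p (-1) s) \<le> B + B"
      by (rule order_trans[OF norm_triangle_ineq4 add_mono]) (auto intro: pB)
    then show ?thesis by (simp add: d_def norm_divide)
  qed
  have eB: "\<bar>e s\<bar> \<le> max B 1" for s
    using c_sq[of s] by (simp add: e_def le_max_iff_disj)
  have K: "(\<lambda>u. (f u, Im u)) ` sphere 0 1 = (\<lambda>(\<sigma>, s). (f (Complex (\<sigma> * e s) (c s)), s)) ` ?X"
    for f :: "complex \<Rightarrow> complex"
    unfolding sphere_eq_image_heights image_image by (intro image_cong) (auto simp: e_def c_id)
  let ?K1 = "(\<lambda>(\<sigma>, s). (of_real \<sigma> * d s, s)) ` ?X"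
  let ?K2 = "(\<lambda>(\<sigma>, s). (of_real (\<sigma> * e s), s)) ` ?X"
  let ?K3 = "(\<lambda>u. (u, Im u)) ` sphere 0 1"
  have "ambient_isotopic ((\<lambda>u. (Q u, Im u)) ` sphere 0 1) ?K1"
  proof -
    let ?K = "(\<lambda>(\<sigma>, s). (Q (Complex (\<sigma> * e s) (c s)), s)) ` ?X"
    have "ambient_isotopic ?K ((\<lambda>x. (fst x + - m (snd x), snd x)) ` ?K)"
      by (rule ambient_isotopic_shear[of "-1" 1])
         (auto intro!: continuous_intros continuous_on_subset[OF m_cont])
    moreover have "(\<lambda>x. (fst x + - m (snd x), snd x)) ` ?K = ?K1"
      unfolding image_image by (intro image_cong) (auto simp: m_def d_def p_def field_simps)
    ultimately show ?thesis unfolding K by simp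
  qed
  also have "ambient_isotopic ?K1 ?K2"
    by (rule ambient_isotopic_rotate_scale[OF d_cont e_cont d0 e0 e_pos dB eB])
  \<comment> \<open>\<open>?K2\<close> is a round circle in a vertical plane. Shearing level
    \<open>s\<close> by \<open>s\<close> in the imaginary direction tilts it to the graph of
    \<open>Im\<close> over the unit circle.\<close>
  also have "ambient_isotopic ?K2 ?K3"
  proof -
    have "ambient_isotopic ?K2 ((\<lambda>x. (fst x + Complex 0 (snd x), snd x)) ` ?K2)"
      by (rule ambient_isotopic_shear[of "-1" 1]) (auto simp: Complex_eq intro!: continuous_intros)
    moreover have "(\<lambda>x. (fst x + Complex 0 (snd x), snd x)) ` ?K2 = ?K3"
      unfolding K image_image by (intro image_cong) (auto simp: c_id complex_eq_iff)
    ultimately show ?thesis by simp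
  qed
  \<comment> \<open>The projection is now injective, so any two height functions are ordered alike
    over every point.\<close>
  also have "ambient_isotopic ?K3 ((\<lambda>u. (u, 0)) ` sphere 0 1)"
    by (rule ambient_isotopic_change_height) (auto intro!: continuous_intros)
  also have "(\<lambda>u. (u, 0)) ` sphere 0 1 = sphere (0 :: complex) 1 \<times> {0 :: real}" by auto
  finally show ?thesis unfolding trivial_knot_def .
qed

section \<open>The descending choice of crossing data\<close>

lemma moebius_homeomorphism_circle:
  fixes a :: real
  assumes a: "0 < a" "a < 1"
  shows "homeomorphism (sphere 0 1) (sphere 0 1)
    (\<lambda>w :: complex. (w + of_real a) / (1 + of_real a * w)) (\<lambda>w. (w - of_real a) / (1 - of_real a * w))"
proof -
  have nz: "1 + of_real b * w \<noteq> 0" if "\<bar>b\<bar> < 1" "norm w = 1" for b and w :: complex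
  proof
    assume "1 + of_real b * w = 0"
    then have "of_real b * w = - 1" by (metis add_eq_0_iff)
    then have "norm (of_real b * w) = 1" by simp
    then show False using that by (simp add: norm_mult)
  qed
  have cnj: "cnj w * w = 1" if "norm w = 1" for w
    using that complex_norm_square[of w] by (simp add: mult.commute)
  have nrm: "norm ((w + of_real b) / (1 + of_real b * w)) = 1" if "\<bar>b\<bar> < 1" "norm w = 1" for b and w :: complex
  proof -
    \<comment> \<open>On the unit circle numerator and denominator therefore have the same modulus.
      Taking \<open>b\<close> to be \<open>a\<close> and \<open>- a\<close> treats the map and its
      inverse together.\<close>
    have "cnj (w + of_real b) * w = 1 + of_real b * w" using cnj[OF that(2)] by (simp add: distrib_right)
    then have "norm (w + of_real b) = norm (1 + of_real b * w)"
      using that(2) by (metis complex_mod_cnj mult.right_neutral norm_mult)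
    then show ?thesis using nz[OF that] by (simp add: norm_divide)
  qed
  have inv: "((w + of_real b) / (1 + of_real b * w) + of_real (- b)) /
      (1 + of_real (- b) * ((w + of_real b) / (1 + of_real b * w))) = w"
    if "\<bar>b\<bar> < 1" "norm w = 1" for b and w :: complex
  proof -
    let ?n = "1 + of_real b * w"
    have "1 - of_real b * of_real b \<noteq> (0 :: complex)"
      using that(1) by (metis abs_square_less_1 less_irrefl of_real_1 of_real_eq_iff of_real_mult power2_eq_square right_minus_eq)
    moreover have "(w + of_real b) / ?n + of_real (- b) = w * (1 - of_real b * of_real b) / ?n"
      using nz[OF that] by (simp add: field_simps)
    moreover have "1 + of_real (- b) * ((w + of_real b) / ?n) = (1 - of_real b * of_real b) / ?n"
      using nz[OF that] by (simp add: field_simps)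
    ultimately show ?thesis using nz[OF that] by simp
  qed
  have ab: "\<bar>a\<bar> < 1" "\<bar>- a\<bar> < 1" using a by auto
  show ?thesis
  proof (rule homeomorphismI)
    show "continuous_on (sphere 0 1) (\<lambda>w :: complex. (w + of_real a) / (1 + of_real a * w))"
      using nz[OF ab(1)] by (intro continuous_intros) auto
    show "continuous_on (sphere 0 1) (\<lambda>w :: complex. (w - of_real a) / (1 - of_real a * w))"
      using nz[OF ab(2)] by (intro continuous_intros) auto
    show "(\<lambda>w :: complex. (w + of_real a) / (1 + of_real a * w)) ` sphere 0 1 \<subseteq> sphere 0 1"
      using nrm[OF ab(1)] by auto
    show "(\<lambda>w :: complex. (w - of_real a) / (1 - of_real a * w)) ` sphere 0 1 \<subseteq> sphere 0 1"
      using nrm[OF ab(2)] by auto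
  qed (use inv[OF ab(1)] inv[OF ab(2)] in auto)
qed

text \<open>Multiplying by the conjugate of the denominator turns the numerator's real part into
  \<open>2 * a + (1 + a\<^sup>2) * Re w\<close>. As \<open>a\<close> tends to 1 this tends to
  \<open>2 * (1 + Re w)\<close>, positive on the circle except at \<open>-1\<close>.\<close>

lemma moebius_Re_pos:
  fixes a :: real and w :: complex
  assumes "norm w = 1" and "2 * a + (1 + a\<^sup>2) * Re w > 0" and "1 + of_real a * w \<noteq> 0"
  shows "Re ((w + of_real a) / (1 + of_real a * w)) > 0"
proof -
  have "(Re w)\<^sup>2 + (Im w)\<^sup>2 = 1" using assms(1) by (simp add: cmod_def)
  then have "(Re w + a) * (1 + a * Re w) + Im w * (a * Im w) = 2 * a + (1 + a\<^sup>2) * Re w" by algebra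
  moreover have "(norm (1 + of_real a * w))\<^sup>2 > 0" using assms(3) by simp
  ultimately show ?thesis using assms(2) unfolding Re_divide' by (simp add: divide_pos_pos)
qed

text \<open>A rotation takes a point \<open>u\<close> outside \<open>Z\<close> to \<open>-1\<close>.
  The Moebius map with \<open>a\<close> close to 1 then pushes the finitely many points of
  \<open>Z\<close>, all away from \<open>-1\<close>, into the right half.\<close>

lemma circle_homeomorphism_into_right_half:
  assumes Z: "finite Z" "Z \<subseteq> sphere (0 :: complex) 1"
  obtains M N where "homeomorphism (sphere 0 1) (sphere 0 1) M N" and "\<And>z. z \<in> Z \<Longrightarrow> Re (M z) > 0"
proof -
  have "{-1..1} \<subseteq> Im ` sphere 0 1" unfolding sphere_eq_image_heights by force
  moreover have "infinite {-1..1 :: real}" by (rule infinite_Icc) simp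
  ultimately have "infinite (sphere (0 :: complex) 1)" using finite_surj by blast
  then have "\<not> sphere 0 1 \<subseteq> Z" using Z finite_subset by blast
  then obtain u where "u \<in> sphere 0 1" "u \<notin> Z" by blast
  then have u: "norm u = 1" "u \<notin> Z" by simp_all
  define R where "R z = - z / u" for z
  have u0: "u \<noteq> 0" using u by auto
  have R: "homeomorphism (sphere 0 1) (sphere 0 1) R (\<lambda>z. - z * u)"
    by (rule homeomorphismI) (use u u0 in \<open>auto simp: R_def norm_divide norm_mult intro!: continuous_intros\<close>)
  have Re_R: "Re (R z) > -1" if "z \<in> Z" for z
  proof -
    have n: "norm (R z) = 1" using that Z u by (auto simp: R_def norm_divide)
    then have sq: "(Re (R z))\<^sup>2 + (Im (R z))\<^sup>2 = 1" by (simp add: cmod_def)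
    have "R z \<noteq> -1" using u u0 that by (auto simp: R_def field_simps)
    then have "Re (R z) \<noteq> -1" using sq by (auto simp: complex_eq_iff)
    moreover have "\<bar>Re (R z)\<bar> \<le> 1" using abs_Re_le_cmod[of "R z"] n by simp
    ultimately show ?thesis by linarith
  qed
  have "eventually (\<lambda>a. 2 * a + (1 + a\<^sup>2) * Re (R z) > 0) (at_left 1)" if z: "z \<in> Z" for z
  proof -
    have "((\<lambda>a. 2 * a + (1 + a\<^sup>2) * Re (R z)) \<longlongrightarrow> 2 * 1 + (1 + 1\<^sup>2) * Re (R z)) (at_left 1)"
      by (intro tendsto_intros)
    then show ?thesis by (rule order_tendstoD) (use Re_R[OF z] in simp)
  qed
  then have "eventually (\<lambda>a. \<forall>z\<in>Z. 2 * a + (1 + a\<^sup>2) * Re (R z) > 0) (at_left 1)"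
    using Z by (simp add: eventually_ball_finite_distrib)
  moreover have "eventually (\<lambda>a. a \<in> {0<..<1}) (at_left (1 :: real))"
    by (rule eventually_at_leftI[of 0]) auto
  ultimately have "\<exists>a. (\<forall>z\<in>Z. 2 * a + (1 + a\<^sup>2) * Re (R z) > 0) \<and> a \<in> {0<..<1}"
    by (intro eventually_happens'[OF trivial_limit_at_left_real] eventually_conj)
  then obtain a where a: "0 < a" "a < 1" and pos: "\<And>z. z \<in> Z \<Longrightarrow> 2 * a + (1 + a\<^sup>2) * Re (R z) > 0"
    by auto
  show thesis
  proof (rule that[OF homeomorphism_compose[OF R moebius_homeomorphism_circle[OF a]]])
    fix z assume z: "z \<in> Z"
    have n: "norm (R z) = 1" using z Z u by (auto simp: R_def norm_divide)
    have "1 + of_real a * R z \<noteq> 0"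
    proof
      assume "1 + of_real a * R z = 0"
      then have "of_real a * R z = - 1" by (metis add_eq_0_iff)
      then have "norm (of_real a * R z) = 1" by simp
      then show False using n a by (simp add: norm_mult)
    qed
    then show "Re (((\<lambda>w. (w + of_real a) / (1 + of_real a * w)) \<circ> R) z) > 0"
      unfolding o_def using pos[OF z] n by (intro moebius_Re_pos)
  qed
qed

section \<open>Descending crossing data and the triviality of every lift\<close>

theorem theorem1p1:
  fixes n :: nat and P :: "complex \<Rightarrow> complex"
  assumes "n \<ge> 2" and "n_crossing_knot_projection n P"
  shows "\<exists>D. crossing_data P D \<and> (\<forall>K. represents P D K \<longrightarrow> trivial_knot K)"
proof -
  let ?S = "sphere 0 1 :: complex set"
  define Z where "Z = (\<Union>p \<in> singular_points P. strands P p)"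
  have P: "continuous_on ?S P" using assms(2) unfolding n_crossing_knot_projection_def by blast
  have "finite Z"
    using assms(2) card_strands(1) unfolding Z_def n_crossing_knot_projection_def by blast
  moreover have Z_sub: "Z \<subseteq> ?S" unfolding Z_def strands_def by blast
  ultimately obtain M N where MN: "homeomorphism ?S ?S M N" and Re_pos: "\<And>z. z \<in> Z \<Longrightarrow> Re (M z) > 0"
    using circle_homeomorphism_into_right_half by blast
  have M: "continuous_on ?S M" "M ` ?S = ?S" and N: "continuous_on ?S N" "N ` ?S = ?S"
    and NM: "\<And>u. u \<in> ?S \<Longrightarrow> N (M u) = u" "\<And>u. u \<in> ?S \<Longrightarrow> M (N u) = u"
    using MN unfolding homeomorphism_def by auto
  have in_Z: "u \<in> Z" if "u \<in> ?S" "v \<in> ?S" "P u = P v" "u \<noteq> v" for u v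
    using that unfolding Z_def singular_points_def strands_def by blast
  \<comment> \<open>Distinct parameters over one point lie in \<open>Z\<close>, hence
    \<open>M\<close> sends them to the open right half circle, where the imaginary part determines
    the point.\<close>
  have eq: "u = v" if uv: "u \<in> ?S" "v \<in> ?S" "P u = P v" "Im (M u) = Im (M v)" for u v
  proof (rule ccontr)
    assume ne: "u \<noteq> v"
    have "Re (M u) > 0" "Re (M v) > 0" using in_Z[of u v] in_Z[of v u] uv ne Re_pos by auto
    moreover have "norm (M u) = 1" "norm (M v) = 1" using M(2) uv by auto
    then have "(Re (M u))\<^sup>2 = (Re (M v))\<^sup>2" using uv(4) by (simp add: cmod_def)
    ultimately have "Re (M u) = Re (M v)" by (simp add: power2_eq_iff)
    then have "M u = M v" using uv(4) by (simp add: complex_eq_iff)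
    then show False using ne NM(1) uv by metis
  qed
  define D where "D p = {(u, v). u \<in> strands P p \<and> v \<in> strands P p \<and> Im (M u) \<ge> Im (M v)}" for p
  have "linear_order_on (strands P p) (D p)" for p
  proof -
    have "antisym (D p)" using eq unfolding D_def by (intro antisymI) (auto simp: strands_def)
    moreover have "refl_on (strands P p) (D p)" unfolding D_def by (auto intro!: refl_onI)
    moreover have "trans (D p)" unfolding D_def by (auto intro!: transI)
    moreover have "total_on (strands P p) (D p)" unfolding D_def by (auto simp: total_on_def)
    ultimately show ?thesis unfolding order_on_defs D_def by auto
  qed
  then have "crossing_data P D" unfolding crossing_data_def by blast
  moreover have "trivial_knot K" if rep: "represents P D K" for K
  proof -
    obtain h where h: "continuous_on ?S h"
      and gt: "\<And>p u v. \<lbrakk>p \<in> singular_points P; (u, v) \<in> D p; u \<noteq> v\<rbrakk> \<Longrightarrow> h u > h v"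
      and K: "K = (\<lambda>u. (P u, h u)) ` ?S"
      using rep unfolding represents_def by blast
    have less: "h v < h u" if "u \<in> ?S" "v \<in> ?S" "P u = P v" "Im (M v) < Im (M u)" for u v
    proof -
      have "u \<noteq> v" using that by auto
      then show ?thesis
        using that by (intro gt[of "P u" u v]) (auto simp: D_def strands_def singular_points_def)
    qed
    \<comment> \<open>Any lift \<open>h\<close> respecting \<open>D\<close> orders the strands over
      each point as \<open>Im (M u)\<close> does; equal values of the latter occur only for equal
      parameters, by \<open>eq\<close>.\<close>
    have "h u \<le> h v \<longleftrightarrow> Im (M u) \<le> Im (M v)" if "u \<in> ?S" "v \<in> ?S" "P u = P v" for u v
      using less[of u v] less[of v u] eq[of u v] that
      by (cases "Im (M u)" "Im (M v)" rule: linorder_cases) auto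
    then have "ambient_isotopic K ((\<lambda>u. (P u, Im (M u))) ` ?S)"
      unfolding K by (intro ambient_isotopic_change_height P h continuous_intros M) auto
    moreover have "trivial_knot ((\<lambda>u. (P u, Im (M u))) ` ?S)"
    proof -
      \<comment> \<open>Reparametrising by \<open>N\<close> makes the height the imaginary part of
        the parameter itself.\<close>
      have "trivial_knot ((\<lambda>u. ((P \<circ> N) u, Im u)) ` ?S)"
      proof (rule trivial_knot_two_points_per_level)
        show "continuous_on ?S (P \<circ> N)" using N P by (intro continuous_on_compose) auto
        show "u = v" if "u \<in> ?S" "v \<in> ?S" "Im u = Im v" "(P \<circ> N) u = (P \<circ> N) v" for u v
        proof -
          have "N u \<in> ?S" "N v \<in> ?S" using N(2) that by blast+
          then have "N u = N v" using eq[of "N u" "N v"] that NM(2) by simp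
          then show ?thesis using NM(2) that by metis
        qed
      qed
      moreover have "(\<lambda>u. ((P \<circ> N) u, Im u)) ` ?S = (\<lambda>u. ((P \<circ> N) u, Im u)) ` M ` ?S"
        using M(2) by simp
      moreover have "\<dots> = (\<lambda>u. (P u, Im (M u))) ` ?S"
        unfolding image_image by (intro image_cong) (use NM in auto)
      ultimately show ?thesis by simp
    qed
    ultimately show ?thesis unfolding trivial_knot_def by (rule ambient_isotopic_trans)
  qed
  ultimately show ?thesis by blast
qed

end
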